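(* Work over $\mathbb{Q}$. Each of the following ten multihomogeneous identities of degree 10 in two variables $a,b$ is satisfied by the anti-tetrad $[a,b,c,d]=abcd-dcba$ in every associative algebra but is not a consequence of the defining identities for anti-Jordan quadruple systems: (1) $[[[a,a,b,a],a,b,a],a,a,a]-[a,[[a,a,a,b],a,b,a],a,a]-[a,[a,[a,a,b,a],a,a],b,a]+[a,[a,[a,a,b,a],b,a],a,a]\equiv0$; (2) $[[[a,a,b,a],a,b,a],b,a,a]+[[a,[a,b,a,b],a,a],b,a,a]-[a,[[a,a,b,a],b,a,a],b,a]-[a,[[a,b,a,b],a,a,b],a,a]-[a,[[a,b,a,b],a,b,a],a,a]-[[a,a,b,a],[a,b,a,b],a,a]\equiv0$; (3) $[[[a,a,b,a],b,b,a],a,a,a]-[a,[[a,a,a,b],a,b,b],a,a]+[a,[[a,a,b,a],a,b,b],a,a]-[a,[[a,a,b,a],b,b,a],a,a]+[a,[[a,a,b,b],a,a,b],a,a]-[a,[[a,a,b,b],a,b,a],a,a]\equiv0$; (4) $[[[a,a,b,a],a,b,a],a,a,b]-[a,[[a,a,a,b],a,b,a],a,b]+[a,[[a,a,b,a],a,a,b],a,b]-[b,[[a,a,b,a],a,b,a],a,a]-[a,[a,[a,a,b,a],a,b],a,b]+[a,[a,[a,a,b,a],b,a],a,b]\equiv0$; (5) $[[a,[a,a,b,a],a,a],b,b,a]-[[a,[a,a,b,a],a,b],a,a,b]+[[a,[a,a,b,a],a,b],b,a,a]+[[a,[a,a,b,b],a,a],b,a,a]-[a,[[a,a,b,a],a,b,b],a,a]-[a,[[a,a,b,b],a,b,a],a,a]+[[a,a,a,b],[a,a,b,a],a,b]-[[a,a,a,b],b,[a,a,b,a],a]\equiv0$;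 (6) $[[[a,a,a,b],a,a,a],b,b,a]-[[[a,a,a,b],a,b,b],a,a,a]+[[a,[a,a,a,b],a,b],b,a,a]-[[a,[a,a,b,a],a,a],b,b,a]+[[a,[a,a,b,b],a,a],a,a,b]-[[a,[a,a,b,b],b,a],a,a,a]+[a,[[a,a,b,a],b,b,a],a,a]-[a,[[a,a,b,b],a,a,b],a,a]+[b,[a,[a,a,a,b],a,b],a,a]-[[a,a,a,b],[a,a,b,b],a,a]\equiv0$; (7) $[[b,[a,a,a,b],a,b],a,a,b]+[[b,[a,a,b,a],a,b],a,a,b]-[b,[[a,a,a,b],b,a,a],a,b]-[b,[[a,a,b,a],a,a,b],a,b]\equiv0$; (8) $[[[a,a,b,a],b,b,a],b,a,a]-[[a,[a,b,a,b],a,a],b,b,a]-[[a,[a,b,a,b],b,a],a,b,a]-[a,[[a,a,b,a],b,a,b],b,a]+[a,[[a,b,a,b],a,a,b],b,a]\equiv0$; (9) $[[[a,a,b,a],b,b,a],b,a,a]-[a,[[a,a,b,a],b,b,a],b,a]-[a,[[a,b,a,b],a,b,b],a,a]+[a,[[b,a,b,b],a,a,b],a,a]-[a,[[b,a,b,b],a,b,a],a,a]\equiv0$; (10) $[[[a,a,b,a],b,b,a],b,a,b]-[a,[[a,b,a,b],a,b,b],a,b]+[a,[[b,a,b,b],a,a,b],a,b]-[a,[[b,a,b,b],a,b,a],a,b]-[b,[[a,a,b,a],b,b,a],b,a]\equiv0$.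
   Context: An anti-Jordan quadruple system (AJQS) over $\mathbb{Q}$ is a vector space $Q$ with a quadrilinear map $[-,-,-,-]\colon Q^4\to Q$ satisfying, for all values of the arguments, the following defining identities: the skew-symmetry $[a,b,c,d]+[d,c,b,a]\equiv0$ and the two identities (i) $[[a,b,c,d],e,f,g]-[[a,b,f,e],d,c,g]+[[d,c,f,e],a,b,g]+[g,[b,a,d,c],f,e]-[g,[b,a,e,f],c,d]+[g,[c,d,e,f],b,a]\equiv0$; (ii) $[[a,b,c,d],e,f,g]-[[a,f,g,c],b,e,d]+[[c,a,b,d],g,e,f]-[[c,b,a,f],g,e,d]-[[c,g,d,b],a,e,f]-[[c,g,e,f],a,b,d]+[[c,g,e,d],b,a,f]-[[b,a,c,f],e,d,g]-[[b,c,f,g],a,e,d]+[[b,e,d,g],a,c,f]-[[g,f,e,d],c,b,a]+[[g,d,e,f],c,a,b]-[[f,a,b,d],e,g,c]-[[f,c,e,d],g,a,b]-[a,[b,c,g,f],e,d]-[c,[a,b,d,g],e,f]+[c,[b,a,f,g],e,d]+[b,[a,c,g,d],e,f]-[b,[a,g,f,c],e,d]+[b,[a,g,d,e],c,f]+[d,[c,b,a,e],f,g]\equiv0$. An identity is satisfied by the anti-tetrad in every associative algebra if it holds whenever the operation is interpreted in an associative algebra as $[x,y,z,w]=xyzw-wzyx$. It is a consequence of the defining identities for AJQS if it holds in every AJQS. *)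

theory Defs
  imports "HOL-Computational_Algebra.Polynomial" "HOL-Library.Multiset" "HOL-Library.Countable_Set"
begin

section \<open>Anti-Jordan quadruple systems\<close>

locale AJQS = vector_space scale
  for scale :: "rat \<Rightarrow> 'q::ab_group_add \<Rightarrow> 'q" +
  fixes br :: "'q \<Rightarrow> 'q \<Rightarrow> 'q \<Rightarrow> 'q \<Rightarrow> 'q"  ("\<langle>_,_,_,_\<rangle>")
  assumes linear1: "\<And>b c d. Vector_Spaces.linear scale scale (\<lambda>a. \<langle>a,b,c,d\<rangle>)"
    and linear2: "\<And>a c d. Vector_Spaces.linear scale scale (\<lambda>b. \<langle>a,b,c,d\<rangle>)"
    and linear3: "\<And>a b d. Vector_Spaces.linear scale scale (\<lambda>c. \<langle>a,b,c,d\<rangle>)"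
    and linear4: "\<And>a b c. Vector_Spaces.linear scale scale (\<lambda>d. \<langle>a,b,c,d\<rangle>)"
    and skew: "\<And>a b c d. \<langle>a,b,c,d\<rangle> + \<langle>d,c,b,a\<rangle> = 0"
    and identity_i: "\<And>a b c d e f g.
       \<langle>\<langle>a,b,c,d\<rangle>,e,f,g\<rangle>
       - \<langle>\<langle>a,b,f,e\<rangle>,d,c,g\<rangle>
       + \<langle>\<langle>d,c,f,e\<rangle>,a,b,g\<rangle>
       + \<langle>g,\<langle>b,a,d,c\<rangle>,f,e\<rangle>
       - \<langle>g,\<langle>b,a,e,f\<rangle>,c,d\<rangle>
       + \<langle>g,\<langle>c,d,e,f\<rangle>,b,a\<rangle> = 0"
    and identity_ii: "\<And>a b c d e f g.
       \<langle>\<langle>a,b,c,d\<rangle>,e,f,g\<rangle>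
       - \<langle>\<langle>a,f,g,c\<rangle>,b,e,d\<rangle>
       + \<langle>\<langle>c,a,b,d\<rangle>,g,e,f\<rangle>
       - \<langle>\<langle>c,b,a,f\<rangle>,g,e,d\<rangle>
       - \<langle>\<langle>c,g,d,b\<rangle>,a,e,f\<rangle>
       - \<langle>\<langle>c,g,e,f\<rangle>,a,b,d\<rangle>
       + \<langle>\<langle>c,g,e,d\<rangle>,b,a,f\<rangle>
       - \<langle>\<langle>b,a,c,f\<rangle>,e,d,g\<rangle>
       - \<langle>\<langle>b,c,f,g\<rangle>,a,e,d\<rangle>
       + \<langle>\<langle>b,e,d,g\<rangle>,a,c,f\<rangle>
       - \<langle>\<langle>g,f,e,d\<rangle>,c,b,a\<rangle>
       + \<langle>\<langle>g,d,e,f\<rangle>,c,a,b\<rangle>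
       - \<langle>\<langle>f,a,b,d\<rangle>,e,g,c\<rangle>
       - \<langle>\<langle>f,c,e,d\<rangle>,g,a,b\<rangle>
       - \<langle>a,\<langle>b,c,g,f\<rangle>,e,d\<rangle>
       - \<langle>c,\<langle>a,b,d,g\<rangle>,e,f\<rangle>
       + \<langle>c,\<langle>b,a,f,g\<rangle>,e,d\<rangle>
       + \<langle>b,\<langle>a,c,g,d\<rangle>,e,f\<rangle>
       - \<langle>b,\<langle>a,g,f,c\<rangle>,e,d\<rangle>
       + \<langle>b,\<langle>a,g,d,e\<rangle>,c,f\<rangle>
       + \<langle>d,\<langle>c,b,a,e\<rangle>,f,g\<rangle> = 0"


section \<open>Associative algebras and the anti-tetrad\<close>

text \<open>The class \<open>ring\<close> does not require a unit, so non-unital algebras are included.\<close>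

locale rat_algebra = vector_space scale
  for scale :: "rat \<Rightarrow> 'r::ring \<Rightarrow> 'r" +
  assumes scale_mult_left: "\<And>c x y. scale c x * y = scale c (x * y)"
    and scale_mult_right: "\<And>c x y. x * scale c y = scale c (x * y)"

definition anti_tetrad :: "'r::ring \<Rightarrow> 'r \<Rightarrow> 'r \<Rightarrow> 'r \<Rightarrow> 'r" where
  "anti_tetrad x y z w = x * y * z * w - w * z * y * x"


section \<open>Identities for a quadrilinear operation\<close>

datatype 'x qmono =
    Var 'x
  | Quad "'x qmono" "'x qmono" "'x qmono" "'x qmono"  ("\<langle>_,_,_,_\<rangle>")

text \<open>A list of pairs \<open>(c, m)\<close> stands for the formal sum of the terms \<open>c m\<close>.\<close>

type_synonym 'x qpoly = "(rat \<times> 'x qmono) list"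

primrec eval_mono :: "('q \<Rightarrow> 'q \<Rightarrow> 'q \<Rightarrow> 'q \<Rightarrow> 'q) \<Rightarrow> ('x \<Rightarrow> 'q) \<Rightarrow> 'x qmono \<Rightarrow> 'q" where
  "eval_mono br v (Var x) = v x"
| "eval_mono br v \<langle>s,t,u,w\<rangle> =
     br (eval_mono br v s) (eval_mono br v t) (eval_mono br v u) (eval_mono br v w)"

definition eval_poly ::
  "(rat \<Rightarrow> 'q \<Rightarrow> 'q) \<Rightarrow> ('q \<Rightarrow> 'q \<Rightarrow> 'q \<Rightarrow> 'q \<Rightarrow> 'q) \<Rightarrow> ('x \<Rightarrow> 'q) \<Rightarrow> 'x qpoly \<Rightarrow> 'q::ab_group_add" where
  "eval_poly scale br v p = (\<Sum>(c, m)\<leftarrow>p. scale c (eval_mono br v m))"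

definition satisfies ::
  "(rat \<Rightarrow> 'q \<Rightarrow> 'q) \<Rightarrow> ('q \<Rightarrow> 'q \<Rightarrow> 'q \<Rightarrow> 'q \<Rightarrow> 'q::ab_group_add) \<Rightarrow> 'x qpoly \<Rightarrow> bool" where
  "satisfies scale br p \<longleftrightarrow> (\<forall>v. eval_poly scale br v p = 0)"

primrec multidegree :: "'x qmono \<Rightarrow> 'x multiset" where
  "multidegree (Var x) = {#x#}"
| "multidegree \<langle>s,t,u,w\<rangle> = multidegree s + multidegree t + multidegree u + multidegree w"

definition multihomogeneous :: "nat \<Rightarrow> 'x qpoly \<Rightarrow> bool" where
  "multihomogeneous n p \<longleftrightarrow> (\<exists>d. size d = n \<and> (\<forall>(c, m) \<in> set p. multidegree m = d))"

text \<open>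
  HOL cannot quantify over types inside a definition, so the AJQS quantified over here are those
  carried by one fixed type, a rational vector space of countably infinite dimension. This is
  no restriction: by \<open>ajqs_consequenceD\<close> below, an identity satisfied by all AJQS on
  \<open>rat poly\<close> is satisfied by every AJQS on every type. The bracket and the
  scalar multiplication on \<open>rat poly\<close> are arbitrary; its ring structure plays no role.
\<close>

definition ajqs_consequence :: "'x qpoly \<Rightarrow> bool" where
  "ajqs_consequence p \<longleftrightarrow>
     (\<forall>(scale :: rat \<Rightarrow> rat poly \<Rightarrow> rat poly) br. AJQS scale br \<longrightarrow> satisfies scale br p)"

instance qmono :: (countable) countable
  by countable_datatype

lemma AJQS_span_closed:
  assumes "AJQS scale br"
    and S: "\<And>a b c d. a \<in> S \<Longrightarrow> b \<in> S \<Longrightarrow> c \<in> S \<Longrightarrow> d \<in> S \<Longrightarrow> br a b c d \<in> module.span scale S"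
    and x: "x \<in> module.span scale S" and y: "y \<in> module.span scale S"
    and z: "z \<in> module.span scale S" and w: "w \<in> module.span scale S"
  shows "br x y z w \<in> module.span scale S"
proof -
  interpret Q: AJQS scale br by fact
  note lin = Q.linear1 Q.linear2 Q.linear3 Q.linear4
  have step: "f u \<in> Q.span S"
    if f: "Vector_Spaces.linear scale scale f" and u: "u \<in> Q.span S"
      and base: "\<And>s. s \<in> S \<Longrightarrow> f s \<in> Q.span S" for f u
  proof -
    interpret F: Vector_Spaces.linear scale scale f by fact
    show ?thesis
      using u by (induction rule: Q.span_induct_alt)
        (auto simp: F.zero F.add F.scale intro: Q.span_zero Q.span_add Q.span_scale base)
  qed
  show ?thesis
    by (rule step[OF Q.linear4 w], rule step[OF Q.linear3 z], rule step[OF Q.linear2 y],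
        rule step[OF Q.linear1 x], rule S)
qed

lemma ajqs_consequenceD:
  fixes p :: "'x::countable qpoly" and scale :: "rat \<Rightarrow> 'q::ab_group_add \<Rightarrow> 'q"
  assumes p: "ajqs_consequence p" and Q: "AJQS scale br"
  shows "satisfies scale br p"
  unfolding satisfies_def
proof
  fix v :: "'x \<Rightarrow> 'q"
  interpret Q: AJQS scale br by fact
  interpret P: vector_space "smult :: rat \<Rightarrow> rat poly \<Rightarrow> rat poly"
    by unfold_locales (simp_all add: smult_add_right smult_add_left)
  interpret PQ: vector_space_pair "smult :: rat \<Rightarrow> rat poly \<Rightarrow> rat poly" scale
    by unfold_locales
  define e where "e n = eval_mono br v (from_nat n :: 'x qmono)" for n
  have e: "eval_mono br v m \<in> range e" for m
    unfolding e_def by (rule range_eqI[of _ _ "to_nat m"]) simp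
  define psi where "psi q = (\<Sum>i\<le>degree q. scale (coeff q i) (e i))" for q
  have psi_eq: "psi q = (\<Sum>i\<le>N. scale (coeff q i) (e i))" if "degree q \<le> N" for q N
    unfolding psi_def by (rule sum.mono_neutral_left) (use that in \<open>auto simp: coeff_eq_0\<close>)
  have psi_add: "psi (q + r) = psi q + psi r" for q r
    using psi_eq[of q "max (degree q) (degree r)"] psi_eq[of r "max (degree q) (degree r)"]
      psi_eq[of "q + r" "max (degree q) (degree r)"]
    by (simp add: degree_add_le_max Q.scale_left_distrib sum.distrib)
  have psi_scale: "psi (smult c q) = scale c (psi q)" for c q
    using psi_eq[of "smult c q" "degree q"] psi_eq[of q "degree q"]
    by (simp add: degree_smult_le Q.scale_sum_right)
  have psi_linear: "Vector_Spaces.linear smult scale psi"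
    unfolding Vector_Spaces.linear_iff using P.vector_space_axioms Q.vector_space_axioms psi_add psi_scale by blast
  interpret psi: Vector_Spaces.linear smult scale psi by (rule psi_linear)
  have psi_monom: "psi (monom 1 n) = e n" for n
    using psi_eq[of "monom 1 n" n]
    by (simp add: degree_monom_le if_distrib[of "\<lambda>c. scale c _"] sum.delta cong: if_cong)
  have range_psi: "range psi = Q.span (range e)"
  proof
    show "range psi \<subseteq> Q.span (range e)"
    proof
      fix u assume "u \<in> range psi"
      then obtain q where "u = psi q" by blast
      then show "u \<in> Q.span (range e)"
        by (simp add: psi_def Q.span_sum Q.span_scale Q.span_base)
    qed
    have "range e \<subseteq> range psi"
      by (metis image_subsetI psi_monom rangeI)
    moreover have "Q.subspace (range psi)"
      using psi.subspace_image[OF P.subspace_UNIV] .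
    ultimately show "Q.span (range e) \<subseteq> range psi"
      by (rule Q.span_minimal)
  qed
  obtain phi where phi_linear: "Vector_Spaces.linear scale smult phi"
    and psi_phi: "\<And>u. u \<in> range psi \<Longrightarrow> psi (phi u) = u"
    using PQ.linear_exists_right_inverse_on[OF psi_linear P.subspace_UNIV] by blast
  interpret phi: Vector_Spaces.linear scale smult phi by (rule phi_linear)
  have closed: "br (psi x) (psi y) (psi z) (psi w) \<in> range psi" for x y z w
    unfolding range_psi
  proof (rule AJQS_span_closed[OF Q])
    show "br a b c d \<in> Q.span (range e)"
      if abcd: "a \<in> range e" "b \<in> range e" "c \<in> range e" "d \<in> range e" for a b c d
    proof -
      obtain i j k l where "a = e i" "b = e j" "c = e k" "d = e l" using abcd by blast
      then have "br a b c d = eval_mono br v \<langle>from_nat i, from_nat j, from_nat k, from_nat l\<rangle>"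
        by (simp add: e_def)
      then show ?thesis using e by (metis Q.span_base)
    qed
  qed (use range_psi in blast)+
  define br' where "br' x y z w = phi (br (psi x) (psi y) (psi z) (psi w))" for x y z w
  have psi_br': "psi (br' x y z w) = br (psi x) (psi y) (psi z) (psi w)" for x y z w
    unfolding br'_def by (rule psi_phi[OF closed])
  have lin: "Vector_Spaces.linear smult smult (\<lambda>x. phi (f (psi x)))"
    if "Vector_Spaces.linear scale scale f" for f
    using Vector_Spaces.linear_compose[OF Vector_Spaces.linear_compose[OF psi_linear that] phi_linear]
    by (simp add: o_def)
  have "AJQS smult br'"
  proof (intro AJQS.intro AJQS_axioms.intro)
    show "vector_space (smult :: rat \<Rightarrow> rat poly \<Rightarrow> rat poly)"
      by (rule P.vector_space_axioms)
  next
    show "Vector_Spaces.linear smult smult (\<lambda>a. br' a b c d)" for b c d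
      unfolding br'_def by (rule lin[OF Q.linear1])
    show "Vector_Spaces.linear smult smult (\<lambda>b. br' a b c d)" for a c d
      unfolding br'_def by (rule lin[OF Q.linear2])
    show "Vector_Spaces.linear smult smult (\<lambda>c. br' a b c d)" for a b d
      unfolding br'_def by (rule lin[OF Q.linear3])
    show "Vector_Spaces.linear smult smult (\<lambda>d. br' a b c d)" for a b c
      unfolding br'_def by (rule lin[OF Q.linear4])
  next
    fix a b c d
    show "br' a b c d + br' d c b a = 0"
      unfolding br'_def phi.add[symmetric] Q.skew by simp
  next
    fix a b c d e f g
    note br'_outer = br'_def[of "br' _ _ _ _"] br'_def[of _ "br' _ _ _ _"]
    show "br' (br' a b c d) e f g
       - br' (br' a b f e) d c g
       + br' (br' d c f e) a b g
       + br' g (br' b a d c) f e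
       - br' g (br' b a e f) c d
       + br' g (br' c d e f) b a = 0"
      unfolding br'_outer psi_br' phi.add[symmetric] phi.diff[symmetric] Q.identity_i by simp
    show "br' (br' a b c d) e f g
       - br' (br' a f g c) b e d
       + br' (br' c a b d) g e f
       - br' (br' c b a f) g e d
       - br' (br' c g d b) a e f
       - br' (br' c g e f) a b d
       + br' (br' c g e d) b a f
       - br' (br' b a c f) e d g
       - br' (br' b c f g) a e d
       + br' (br' b e d g) a c f
       - br' (br' g f e d) c b a
       + br' (br' g d e f) c a b
       - br' (br' f a b d) e g c
       - br' (br' f c e d) g a b
       - br' a (br' b c g f) e d
       - br' c (br' a b d g) e f
       + br' c (br' b a f g) e d
       + br' b (br' a c g d) e f
       - br' b (br' a g f c) e d
       + br' b (br' a g d e) c f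
       + br' d (br' c b a e) f g = 0"
      unfolding br'_outer psi_br' phi.add[symmetric] phi.diff[symmetric] Q.identity_ii by simp
  qed
  then have "eval_poly smult br' (phi \<circ> v) p = 0"
    using p unfolding ajqs_consequence_def satisfies_def by blast
  then have "psi (eval_poly smult br' (phi \<circ> v) p) = 0"
    by simp
  moreover have mono: "psi (eval_mono br' (phi \<circ> v) m) = eval_mono br v m" for m
  proof (induction m)
    case (Var x)
    show ?case
      using psi_phi[of "v x"] range_psi Q.span_base[OF e[of "Var x"]] by simp
  qed (simp add: psi_br')
  moreover have "psi (eval_poly smult br' (phi \<circ> v) p) = eval_poly scale br v p"
    unfolding eval_poly_def
    by (induction p) (auto simp: psi.add psi.scale mono mono[unfolded comp_def])
  ultimately show "eval_poly scale br v p = 0"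
    by simp
qed

section \<open>The ten identities\<close>

datatype var = A | B

definition identities :: "var qpoly list" where
  "identities = (let a = Var A; b = Var B in [
      [(1, \<langle>\<langle>\<langle>a,a,b,a\<rangle>,a,b,a\<rangle>,a,a,a\<rangle>),
       (-1, \<langle>a,\<langle>\<langle>a,a,a,b\<rangle>,a,b,a\<rangle>,a,a\<rangle>),
       (-1, \<langle>a,\<langle>a,\<langle>a,a,b,a\<rangle>,a,a\<rangle>,b,a\<rangle>),
       (1, \<langle>a,\<langle>a,\<langle>a,a,b,a\<rangle>,b,a\<rangle>,a,a\<rangle>)],
      [(1, \<langle>\<langle>\<langle>a,a,b,a\<rangle>,a,b,a\<rangle>,b,a,a\<rangle>),
       (1, \<langle>\<langle>a,\<langle>a,b,a,b\<rangle>,a,a\<rangle>,b,a,a\<rangle>),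
       (-1, \<langle>a,\<langle>\<langle>a,a,b,a\<rangle>,b,a,a\<rangle>,b,a\<rangle>),
       (-1, \<langle>a,\<langle>\<langle>a,b,a,b\<rangle>,a,a,b\<rangle>,a,a\<rangle>),
       (-1, \<langle>a,\<langle>\<langle>a,b,a,b\<rangle>,a,b,a\<rangle>,a,a\<rangle>),
       (-1, \<langle>\<langle>a,a,b,a\<rangle>,\<langle>a,b,a,b\<rangle>,a,a\<rangle>)],
      [(1, \<langle>\<langle>\<langle>a,a,b,a\<rangle>,b,b,a\<rangle>,a,a,a\<rangle>),
       (-1, \<langle>a,\<langle>\<langle>a,a,a,b\<rangle>,a,b,b\<rangle>,a,a\<rangle>),
       (1, \<langle>a,\<langle>\<langle>a,a,b,a\<rangle>,a,b,b\<rangle>,a,a\<rangle>),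
       (-1, \<langle>a,\<langle>\<langle>a,a,b,a\<rangle>,b,b,a\<rangle>,a,a\<rangle>),
       (1, \<langle>a,\<langle>\<langle>a,a,b,b\<rangle>,a,a,b\<rangle>,a,a\<rangle>),
       (-1, \<langle>a,\<langle>\<langle>a,a,b,b\<rangle>,a,b,a\<rangle>,a,a\<rangle>)],
      [(1, \<langle>\<langle>\<langle>a,a,b,a\<rangle>,a,b,a\<rangle>,a,a,b\<rangle>),
       (-1, \<langle>a,\<langle>\<langle>a,a,a,b\<rangle>,a,b,a\<rangle>,a,b\<rangle>),
       (1, \<langle>a,\<langle>\<langle>a,a,b,a\<rangle>,a,a,b\<rangle>,a,b\<rangle>),
       (-1, \<langle>b,\<langle>\<langle>a,a,b,a\<rangle>,a,b,a\<rangle>,a,a\<rangle>),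
       (-1, \<langle>a,\<langle>a,\<langle>a,a,b,a\<rangle>,a,b\<rangle>,a,b\<rangle>),
       (1, \<langle>a,\<langle>a,\<langle>a,a,b,a\<rangle>,b,a\<rangle>,a,b\<rangle>)],
      [(1, \<langle>\<langle>a,\<langle>a,a,b,a\<rangle>,a,a\<rangle>,b,b,a\<rangle>),
       (-1, \<langle>\<langle>a,\<langle>a,a,b,a\<rangle>,a,b\<rangle>,a,a,b\<rangle>),
       (1, \<langle>\<langle>a,\<langle>a,a,b,a\<rangle>,a,b\<rangle>,b,a,a\<rangle>),
       (1, \<langle>\<langle>a,\<langle>a,a,b,b\<rangle>,a,a\<rangle>,b,a,a\<rangle>),
       (-1, \<langle>a,\<langle>\<langle>a,a,b,a\<rangle>,a,b,b\<rangle>,a,a\<rangle>),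
       (-1, \<langle>a,\<langle>\<langle>a,a,b,b\<rangle>,a,b,a\<rangle>,a,a\<rangle>),
       (1, \<langle>\<langle>a,a,a,b\<rangle>,\<langle>a,a,b,a\<rangle>,a,b\<rangle>),
       (-1, \<langle>\<langle>a,a,a,b\<rangle>,b,\<langle>a,a,b,a\<rangle>,a\<rangle>)],
      [(1, \<langle>\<langle>\<langle>a,a,a,b\<rangle>,a,a,a\<rangle>,b,b,a\<rangle>),
       (-1, \<langle>\<langle>\<langle>a,a,a,b\<rangle>,a,b,b\<rangle>,a,a,a\<rangle>),
       (1, \<langle>\<langle>a,\<langle>a,a,a,b\<rangle>,a,b\<rangle>,b,a,a\<rangle>),
       (-1, \<langle>\<langle>a,\<langle>a,a,b,a\<rangle>,a,a\<rangle>,b,b,a\<rangle>),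
       (1, \<langle>\<langle>a,\<langle>a,a,b,b\<rangle>,a,a\<rangle>,a,a,b\<rangle>),
       (-1, \<langle>\<langle>a,\<langle>a,a,b,b\<rangle>,b,a\<rangle>,a,a,a\<rangle>),
       (1, \<langle>a,\<langle>\<langle>a,a,b,a\<rangle>,b,b,a\<rangle>,a,a\<rangle>),
       (-1, \<langle>a,\<langle>\<langle>a,a,b,b\<rangle>,a,a,b\<rangle>,a,a\<rangle>),
       (1, \<langle>b,\<langle>a,\<langle>a,a,a,b\<rangle>,a,b\<rangle>,a,a\<rangle>),
       (-1, \<langle>\<langle>a,a,a,b\<rangle>,\<langle>a,a,b,b\<rangle>,a,a\<rangle>)],
      [(1, \<langle>\<langle>b,\<langle>a,a,a,b\<rangle>,a,b\<rangle>,a,a,b\<rangle>),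
       (1, \<langle>\<langle>b,\<langle>a,a,b,a\<rangle>,a,b\<rangle>,a,a,b\<rangle>),
       (-1, \<langle>b,\<langle>\<langle>a,a,a,b\<rangle>,b,a,a\<rangle>,a,b\<rangle>),
       (-1, \<langle>b,\<langle>\<langle>a,a,b,a\<rangle>,a,a,b\<rangle>,a,b\<rangle>)],
      [(1, \<langle>\<langle>\<langle>a,a,b,a\<rangle>,b,b,a\<rangle>,b,a,a\<rangle>),
       (-1, \<langle>\<langle>a,\<langle>a,b,a,b\<rangle>,a,a\<rangle>,b,b,a\<rangle>),
       (-1, \<langle>\<langle>a,\<langle>a,b,a,b\<rangle>,b,a\<rangle>,a,b,a\<rangle>),
       (-1, \<langle>a,\<langle>\<langle>a,a,b,a\<rangle>,b,a,b\<rangle>,b,a\<rangle>),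
       (1, \<langle>a,\<langle>\<langle>a,b,a,b\<rangle>,a,a,b\<rangle>,b,a\<rangle>)],
      [(1, \<langle>\<langle>\<langle>a,a,b,a\<rangle>,b,b,a\<rangle>,b,a,a\<rangle>),
       (-1, \<langle>a,\<langle>\<langle>a,a,b,a\<rangle>,b,b,a\<rangle>,b,a\<rangle>),
       (-1, \<langle>a,\<langle>\<langle>a,b,a,b\<rangle>,a,b,b\<rangle>,a,a\<rangle>),
       (1, \<langle>a,\<langle>\<langle>b,a,b,b\<rangle>,a,a,b\<rangle>,a,a\<rangle>),
       (-1, \<langle>a,\<langle>\<langle>b,a,b,b\<rangle>,a,b,a\<rangle>,a,a\<rangle>)],
      [(1, \<langle>\<langle>\<langle>a,a,b,a\<rangle>,b,b,a\<rangle>,b,a,b\<rangle>),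
       (-1, \<langle>a,\<langle>\<langle>a,b,a,b\<rangle>,a,b,b\<rangle>,a,b\<rangle>),
       (1, \<langle>a,\<langle>\<langle>b,a,b,b\<rangle>,a,a,b\<rangle>,a,b\<rangle>),
       (-1, \<langle>a,\<langle>\<langle>b,a,b,b\<rangle>,a,b,a\<rangle>,a,b\<rangle>),
       (-1, \<langle>b,\<langle>\<langle>a,a,b,a\<rangle>,b,b,a\<rangle>,b,a\<rangle>)]])"

end

(*
  All ten identities fail in one nilpotent anti-Jordan quadruple system with basis a, b, u, v, w, z
  in bidegrees (1,0), (0,1), (3,1), (6,1), (5,2), (8,2).  It is a quotient of the free
  system on a, b: in bidegree (8,2) the kernel of the map to the free associative algebra is
  one-dimensional, so there is a linear functional that does not vanish on identity (1), and one
  factors out a large ideal on which this functional vanishes.  The evaluation A = a + b, B = a is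
  not homogeneous, so that identities of every bidegree acquire a component of bidegree (8,2);
  this component turns out to be a nonzero multiple of z for all ten of them.
*)

theory Submission
  imports Defs
begin

lemma identities_multihomogeneous:
  "p \<in> set identities \<Longrightarrow> multihomogeneous 10 p"
  unfolding identities_def Let_def multihomogeneous_def by auto

text \<open>Expanded into words in two noncommuting letters, each identity cancels word by word; no
  unit is required.\<close>

lemma identities_anti_tetrad:
  fixes scale :: "rat \<Rightarrow> 'r::ring \<Rightarrow> 'r"
  assumes "rat_algebra scale" and "p \<in> set identities"
  shows "satisfies scale anti_tetrad p"
proof -
  interpret rat_algebra scale by fact
  show ?thesis
    using assms(2) unfolding identities_def Let_def satisfies_def eval_poly_def
    by (auto simp: anti_tetrad_def algebra_simps)
qed

text \<open>A product of four coordinate functionals, antisymmetrised under reversal of the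
  arguments, so that every combination of such forms satisfies the skew-symmetry axiom.\<close>

definition skew_coeff ::
  "rat poly \<Rightarrow> rat poly \<Rightarrow> rat poly \<Rightarrow> rat poly \<Rightarrow> nat \<Rightarrow> nat \<Rightarrow> nat \<Rightarrow> nat \<Rightarrow> rat" where
  "skew_coeff x y z w i j k l =
     coeff x i * coeff y j * coeff z k * coeff w l - coeff w i * coeff z j * coeff y k * coeff x l"

text \<open>
  The coefficients of degrees 0 to 5 are the coordinates with respect to a, b, u, v, w, z.
\<close>

definition bracket :: "rat poly \<Rightarrow> rat poly \<Rightarrow> rat poly \<Rightarrow> rat poly \<Rightarrow> rat poly" where
  "bracket x y z w = (let s = skew_coeff x y z w in
     [:0, 0,
       s 0 1 0 0,
       - s 0 2 0 0,
       s 0 2 1 0 - 3 * s 1 0 2 0 + 2 * s 1 2 0 0 - s 2 0 0 1 + s 2 1 0 0,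
       s 0 4 0 0 - 4 * s 0 3 1 0 + 2 * s 1 0 3 0 - 4 * s 1 3 0 0 - s 2 0 2 0 + s 2 2 0 0
         - 2 * s 3 0 0 1 + 2 * s 3 0 1 0:])"

lemma coeff_bracket:
  "coeff (bracket x y z w) 0 = 0"
  "coeff (bracket x y z w) 1 = 0"
  "coeff (bracket x y z w) 2 = skew_coeff x y z w 0 1 0 0"
  "coeff (bracket x y z w) 3 = - skew_coeff x y z w 0 2 0 0"
  "coeff (bracket x y z w) 4 =
     skew_coeff x y z w 0 2 1 0 - 3 * skew_coeff x y z w 1 0 2 0 + 2 * skew_coeff x y z w 1 2 0 0
       - skew_coeff x y z w 2 0 0 1 + skew_coeff x y z w 2 1 0 0"
  "coeff (bracket x y z w) 5 =
     skew_coeff x y z w 0 4 0 0 - 4 * skew_coeff x y z w 0 3 1 0 + 2 * skew_coeff x y z w 1 0 3 0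
       - 4 * skew_coeff x y z w 1 3 0 0 - skew_coeff x y z w 2 0 2 0 + skew_coeff x y z w 2 2 0 0
       - 2 * skew_coeff x y z w 3 0 0 1 + 2 * skew_coeff x y z w 3 0 1 0"
  by (simp_all add: bracket_def Let_def coeff_pCons)

lemma coeff_bracket_eq_0: "n \<notin> {2, 3, 4, 5} \<Longrightarrow> coeff (bracket x y z w) n = 0"
  by (auto simp: bracket_def Let_def coeff_pCons split: nat.split)

text \<open>The monomials of degree above 5 only fill up the carrier: any bracket with one of them
  as an argument is zero.\<close>

lemma AJQS_bracket: "AJQS smult bracket"
proof (intro AJQS.intro AJQS_axioms.intro)
  show vs: "vector_space (smult :: rat \<Rightarrow> rat poly \<Rightarrow> rat poly)"
    by unfold_locales (simp_all add: smult_add_right smult_add_left)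
  fix a b c d e f g :: "rat poly"
  have lin: "Vector_Spaces.linear smult smult h"
    if "\<And>x y. h (x + y) = h x + h y" "\<And>r x. h (smult r x) = smult r (h x)"
    for h :: "rat poly \<Rightarrow> rat poly"
    using vs that unfolding Vector_Spaces.linear_iff by blast
  show "Vector_Spaces.linear smult smult (\<lambda>a. bracket a b c d)"
    "Vector_Spaces.linear smult smult (\<lambda>b. bracket a b c d)"
    "Vector_Spaces.linear smult smult (\<lambda>c. bracket a b c d)"
    "Vector_Spaces.linear smult smult (\<lambda>d. bracket a b c d)"
    by (rule lin; simp add: bracket_def Let_def skew_coeff_def algebra_simps)+
  show "bracket a b c d + bracket d c b a = 0"
    by (simp add: bracket_def Let_def skew_coeff_def)
  \<comment> \<open>Brackets have only u, v, w, z coordinates. In each of these, (i) and (ii) become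
    polynomial identities in the coordinates of the seven arguments.\<close>
  have cases: "n = 2 \<or> n = 3 \<or> n = 4 \<or> n = 5 \<or> n \<notin> {2, 3, 4, 5}" for n :: nat
    by blast
  note coeffs = coeff_diff coeff_add coeff_0 coeff_bracket skew_coeff_def
  show "bracket (bracket a b c d) e f g
       - bracket (bracket a b f e) d c g
       + bracket (bracket d c f e) a b g
       + bracket g (bracket b a d c) f e
       - bracket g (bracket b a e f) c d
       + bracket g (bracket c d e f) b a = 0" (is "?i = 0")
  proof (rule poly_eqI)
    have "coeff ?i 2 = 0" "coeff ?i 3 = 0" "coeff ?i 4 = 0" "coeff ?i 5 = 0"
      unfolding coeffs by algebra+
    then show "coeff ?i n = coeff 0 n" for n
      using cases[of n] by (auto simp: coeff_bracket_eq_0)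
  qed
  show "bracket (bracket a b c d) e f g
       - bracket (bracket a f g c) b e d
       + bracket (bracket c a b d) g e f
       - bracket (bracket c b a f) g e d
       - bracket (bracket c g d b) a e f
       - bracket (bracket c g e f) a b d
       + bracket (bracket c g e d) b a f
       - bracket (bracket b a c f) e d g
       - bracket (bracket b c f g) a e d
       + bracket (bracket b e d g) a c f
       - bracket (bracket g f e d) c b a
       + bracket (bracket g d e f) c a b
       - bracket (bracket f a b d) e g c
       - bracket (bracket f c e d) g a b
       - bracket a (bracket b c g f) e d
       - bracket c (bracket a b d g) e f
       + bracket c (bracket b a f g) e d
       + bracket b (bracket a c g d) e f
       - bracket b (bracket a g f c) e d
       + bracket b (bracket a g d e) c f
       + bracket d (bracket c b a e) f g = 0" (is "?ii = 0")
  proof (rule poly_eqI)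
    have "coeff ?ii 2 = 0" "coeff ?ii 3 = 0" "coeff ?ii 4 = 0" "coeff ?ii 5 = 0"
      unfolding coeffs by algebra+
    then show "coeff ?ii n = coeff 0 n" for n
      using cases[of n] by (auto simp: coeff_bracket_eq_0)
  qed
qed

text \<open>The values substituted are a + b for \<open>A\<close> and a for \<open>B\<close>. As z
  is the only basis vector of total degree 10, each result is a multiple of z, with a coefficient
  found by computation.\<close>

lemma identities_fail:
  assumes "p \<in> set identities"
  shows "eval_poly smult bracket (case_var [:1, 1:] [:1:]) p \<noteq> 0"
  using assms unfolding identities_def Let_def eval_poly_def
  by (auto simp: bracket_def Let_def skew_coeff_def coeff_pCons)

theorem theorem7p4:
  shows "\<forall>p \<in> set identities.
           multihomogeneous 10 p \<and>
           (\<forall>scale :: rat \<Rightarrow> 'r::ring \<Rightarrow> 'r. rat_algebra scale \<longrightarrow> satisfies scale anti_tetrad p) \<and>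
           \<not> ajqs_consequence p"
  using identities_multihomogeneous identities_anti_tetrad identities_fail AJQS_bracket
  unfolding ajqs_consequence_def satisfies_def by blast

end
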